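(* Let $G=(V,E)$ be a connected undirected graph with $N$ nodes $v_1,\dots,v_N$, let $0<\underline a<\bar a<1$, and for every $k\ge 0$ let the weights satisfy $a_{j\to i}^{(k)}\in[\underline a,\bar a]$. Then the update rule $$x_i[k+1]=x_i[k]+\max_{v_j\in N_i\cup\{v_i\}}a_{j\to i}^{(k)}\,(x_j[k]-x_i[k]),\qquad k\ge0,\ i=1,\dots,N,$$ achieves maximum consensus, i.e. $$\lim_{k\to\infty}x_i[k]=\max_{1\le j\le N}x_j[0],\qquad i=1,2,\dots,N.$$
   Context: $N_i=\{v_j\in V:(v_i,v_j)\in E\}$ is the neighbor set of $v_i$, and $x_i[k]\in\mathbb{R}$ is the state of node $v_i$ at iteration $k$, with arbitrary initial states. The weight $a_{j\to i}^{(k)}$ is chosen at random by node $v_j$ at iteration $k$ within the confidential interaction protocol (in which node $v_i$ receives from $v_j$ the quantity $a_{j\to i}^{(k)}(x_j[k]-x_i[k])$ by encrypted exchange). The weights may vary with $k$ and need not be symmetric ($a_{j\to i}^{(k)}\ne a_{i\to j}^{(k)}$ is allowed); the statement holds for every realization of the weights in $[\underline a,\bar a]$. Encryption and quantization play no role in the statement. *)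

theory Defs
  imports Complex_Main "Graph_Theory.Graph_Theory"
begin

text \<open>An undirected graph is a finite symmetric digraph on ordered pairs, i.e.
  \<^const>\<open>pair_pseudo_graph\<close>, whose edge relation is \<^const>\<open>parcs\<close>. Loops are not excluded;
  they never affect the update rule below, which already includes the node itself.\<close>

definition neighbors :: "'v pair_pre_digraph \<Rightarrow> 'v \<Rightarrow> 'v set" where
  "neighbors G i = {j \<in> pverts G. (i, j) \<in> parcs G}"

text \<open>\<open>a k j i\<close> is the weight chosen by \<open>j\<close> for its transmission to \<open>i\<close> at iteration \<open>k\<close>
  (sender first), and \<open>x k i\<close> is the state of node \<open>i\<close> at iteration \<open>k\<close>.\<close>

definition weights_in ::
    "'v pair_pre_digraph \<Rightarrow> real \<Rightarrow> real \<Rightarrow> (nat \<Rightarrow> 'v \<Rightarrow> 'v \<Rightarrow> real) \<Rightarrow> bool" where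
  "weights_in G lo hi a \<longleftrightarrow>
     (\<forall>k. \<forall>i\<in>pverts G. \<forall>j\<in>neighbors G i \<union> {i}. a k j i \<in> {lo..hi})"

definition max_update_rule ::
    "'v pair_pre_digraph \<Rightarrow> (nat \<Rightarrow> 'v \<Rightarrow> 'v \<Rightarrow> real) \<Rightarrow> (nat \<Rightarrow> 'v \<Rightarrow> real) \<Rightarrow> bool" where
  "max_update_rule G a x \<longleftrightarrow>
     (\<forall>k. \<forall>i\<in>pverts G.
        x (k + 1) i = x k i + (MAX j\<in>neighbors G i \<union> {i}. a k j i * (x k j - x k i)))"

definition max_consensus :: "'v pair_pre_digraph \<Rightarrow> (nat \<Rightarrow> 'v \<Rightarrow> real) \<Rightarrow> bool" where
  "max_consensus G x \<longleftrightarrow>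
     (\<forall>i\<in>pverts G. (\<lambda>k. x k i) \<longlonglongrightarrow> (MAX j\<in>pverts G. x 0 j))"

end

theory Submission
  imports Defs
begin

text \<open>Every trajectory is nondecreasing, because the term of the node itself in the maximum is zero,
  and it stays below the initial maximum \<open>M\<close>, because the weights are at most one. A node that
  starts at \<open>M\<close> therefore stays there. If \<open>x\<^sub>j\<close> tends to \<open>M\<close> and \<open>j\<close> is a neighbor of \<open>i\<close>,
  then \<open>x\<^sub>i\<close> has a limit \<open>L \<le> M\<close>, and passing to the limit in
  \<open>x\<^sub>i[k+1] - x\<^sub>i[k] \<ge> a_lo (x\<^sub>j[k] - x\<^sub>i[k])\<close> gives \<open>0 \<ge> a_lo (M - L)\<close>, so \<open>L = M\<close>.
  Connectedness spreads the limit \<open>M\<close> to all nodes.\<close>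

locale max_update =
  pair_pseudo_graph G for G :: "'v pair_pre_digraph" +
  fixes lo hi :: real
    and a :: "nat \<Rightarrow> 'v \<Rightarrow> 'v \<Rightarrow> real"
    and x :: "nat \<Rightarrow> 'v \<Rightarrow> real"
  assumes lo_pos: "0 < lo" and hi_le_1: "hi \<le> 1"
    and weights: "weights_in G lo hi a"
    and update: "max_update_rule G a x"
begin

lemma finite_neighbors: "finite (neighbors G i)"
  unfolding neighbors_def using pair_finite_verts by simp

lemma weight_bounds:
  assumes "i \<in> pverts G" "j \<in> neighbors G i \<union> {i}"
  shows "lo \<le> a k j i" "a k j i \<le> 1"
proof -
  have "a k j i \<in> {lo..hi}"
    using assms weights unfolding weights_in_def by blast
  then show "lo \<le> a k j i" "a k j i \<le> 1"
    using hi_le_1 by auto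
qed

lemma update_eq:
  assumes "i \<in> pverts G"
  shows "x (Suc k) i = x k i + (MAX j\<in>neighbors G i \<union> {i}. a k j i * (x k j - x k i))"
  using assms update unfolding max_update_rule_def by simp

lemma increment_ge:
  assumes "i \<in> pverts G" "j \<in> neighbors G i \<union> {i}"
  shows "a k j i * (x k j - x k i) \<le> x (Suc k) i - x k i"
proof -
  have "a k j i * (x k j - x k i) \<le> (MAX j\<in>neighbors G i \<union> {i}. a k j i * (x k j - x k i))"
    using assms(2) finite_neighbors by (intro Max_ge) auto
  then show ?thesis
    using update_eq[OF assms(1)] by simp
qed

lemma state_le_Suc:
  assumes "i \<in> pverts G"
  shows "x k i \<le> x (Suc k) i"
  using increment_ge[OF assms, of i k] by simp

lemma incseq_state:
  assumes "i \<in> pverts G"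
  shows "incseq (\<lambda>k. x k i)"
  using state_le_Suc[OF assms] by (rule incseq_SucI)

text \<open>Replacing the weight, which varies with \<open>k\<close>, by the constant
  \<open>lo\<close> makes both sides converge along with the states. For a nonnegative difference
  this follows from \<open>lo \<le> a k j i\<close>; for a negative one the left side is negative
  and monotonicity suffices.\<close>

lemma increment_ge_lo:
  assumes "i \<in> pverts G" "j \<in> neighbors G i"
  shows "lo * (x k j - x k i) \<le> x (Suc k) i - x k i"
proof (cases "x k i \<le> x k j")
  case True
  have "lo * (x k j - x k i) \<le> a k j i * (x k j - x k i)"
    using True weight_bounds(1)[OF assms(1)] assms(2) by (intro mult_right_mono) auto
  also have "\<dots> \<le> x (Suc k) i - x k i"
    using increment_ge assms by blast
  finally show ?thesis .
next
  case False
  then have "lo * (x k j - x k i) \<le> 0"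
    using lo_pos by (simp add: mult_le_0_iff)
  also have "0 \<le> x (Suc k) i - x k i"
    using state_le_Suc[OF assms(1)] by simp
  finally show ?thesis .
qed

text \<open>With weights in [0, 1], each candidate for the new state,
  \<open>x k i + a k j i * (x k j - x k i)\<close>, is a convex combination of two states that the
  induction hypothesis bounds by \<open>M\<close>.\<close>

lemma state_le_bound:
  assumes "\<And>i. i \<in> pverts G \<Longrightarrow> x 0 i \<le> M" "i \<in> pverts G"
  shows "x k i \<le> M"
  using assms(2)
proof (induction k arbitrary: i)
  case 0
  then show ?case using assms(1) by simp
next
  case (Suc k)
  have "a k j i * (x k j - x k i) \<le> M - x k i" if j: "j \<in> neighbors G i \<union> {i}" for j
  proof -
    have "j \<in> pverts G"
      using j Suc.prems unfolding neighbors_def by auto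
    then have "a k j i * (x k j - x k i) \<le> a k j i * (M - x k i)"
      using Suc.IH weight_bounds(1)[OF Suc.prems j, of k] lo_pos by (intro mult_left_mono) auto
    also have "\<dots> \<le> M - x k i"
      using weight_bounds[OF Suc.prems j, of k] lo_pos Suc.IH[OF Suc.prems]
      by (intro mult_left_le_one_le) auto
    finally show ?thesis .
  qed
  then have "(MAX j\<in>neighbors G i \<union> {i}. a k j i * (x k j - x k i)) \<le> M - x k i"
    using finite_neighbors Suc.IH[OF Suc.prems] by (intro Max.boundedI) auto
  then show ?case
    using update_eq[OF Suc.prems] by simp
qed

lemma tendsto_bound_neighbor:
  assumes M: "\<And>i. i \<in> pverts G \<Longrightarrow> x 0 i \<le> M"
    and i: "i \<in> pverts G" and j: "j \<in> neighbors G i"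
    and lim_j: "(\<lambda>k. x k j) \<longlonglongrightarrow> M"
  shows "(\<lambda>k. x k i) \<longlonglongrightarrow> M"
proof -
  obtain L where L: "(\<lambda>k. x k i) \<longlonglongrightarrow> L"
    using incseq_convergent[OF incseq_state[OF i], of M] state_le_bound[OF M i] by blast
  have "L \<le> M"
    using LIMSEQ_le_const2[OF L] state_le_bound[OF M i] by blast
  \<comment> \<open>The right side \<open>L - L\<close> is the limit of the increments of node
    \<open>i\<close>.\<close>
  moreover have "lo * (M - L) \<le> L - L"
  proof (rule LIMSEQ_le)
    show "(\<lambda>k. lo * (x k j - x k i)) \<longlonglongrightarrow> lo * (M - L)"
      by (intro tendsto_intros lim_j L)
    show "(\<lambda>k. x (Suc k) i - x k i) \<longlonglongrightarrow> L - L"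
      by (intro tendsto_diff L LIMSEQ_Suc[OF L])
    show "\<exists>N. \<forall>k\<ge>N. lo * (x k j - x k i) \<le> x (Suc k) i - x k i"
      using increment_ge_lo[OF i j] by blast
  qed
  then have "M \<le> L"
    using lo_pos by (simp add: mult_le_0_iff)
  ultimately show ?thesis
    using L by simp
qed

lemma connected_imp_max_consensus:
  assumes "Digraph_Component.connected (with_proj G)"
  shows "max_consensus G x"
proof -
  have strong: "strongly_connected (with_proj G)"
    using symmetric_connected_imp_strongly_connected[OF sym_arcs assms] .
  define M where "M = (MAX j\<in>pverts G. x 0 j)"
  have M: "x 0 i \<le> M" if "i \<in> pverts G" for i
    unfolding M_def using that pair_finite_verts by simp
  \<comment> \<open>Strong connectedness includes that there is a vertex, so the maximum is
    attained.\<close>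
  have "M \<in> x 0 ` pverts G"
    unfolding M_def using strong pair_finite_verts
    by (intro Max_in) (auto simp: strongly_connected_def)
  then obtain m where m: "m \<in> pverts G" "x 0 m = M"
    by auto
  have "x k m = M" for k
    using state_le_bound[OF M m(1), of k] incseqD[OF incseq_state[OF m(1)], of 0 k] m(2) by simp
  then have lim_m: "(\<lambda>k. x k m) \<longlonglongrightarrow> M"
    by simp
  have "(\<lambda>k. x k i) \<longlonglongrightarrow> M" if "i \<in> pverts G" for i
  proof -
    have "i \<rightarrow>\<^sup>*\<^bsub>with_proj G\<^esub> m"
      using strong that m(1) by (auto simp: strongly_connected_def)
    then show ?thesis
    \<comment> \<open>The path to \<open>m\<close> is built backwards from its end, so the limit
      passes from \<open>j\<close> to \<open>i\<close> against each arc from \<open>i\<close> to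
      \<open>j\<close>.\<close>
    proof (induction rule: converse_reachable_induct)
      case base
      show ?case by (rule lim_m)
    next
      case (step i j)
      then have "i \<in> pverts G" "j \<in> neighbors G i"
        using adj_in_verts by (auto simp: neighbors_def)
      then show ?case
        using tendsto_bound_neighbor M step.IH by blast
    qed
  qed
  then show ?thesis
    unfolding max_consensus_def M_def by blast
qed

end

theorem theorem6:
  fixes G :: "'v pair_pre_digraph"
    and a_lo a_hi :: real
    and a :: "nat \<Rightarrow> 'v \<Rightarrow> 'v \<Rightarrow> real"
    and x :: "nat \<Rightarrow> 'v \<Rightarrow> real"
  assumes "pair_pseudo_graph G"
    and "Digraph_Component.connected (with_proj G)"
    and "0 < a_lo" and "a_lo < a_hi" and "a_hi < 1"
    and "weights_in G a_lo a_hi a"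
    and "max_update_rule G a x"
  shows "max_consensus G x"
proof -
  interpret pair_pseudo_graph G by fact
  interpret max_update G a_lo a_hi a x
    using assms by unfold_locales auto
  show ?thesis
    using assms(2) by (rule connected_imp_max_consensus)
qed

end
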